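(* The algorithms $\mathtt{Carray2Dtableau}$ and $\mathtt{Dtableau2Carray}$ are correct: for every c-array $S$, $\mathtt{Carray2Dtableau}(S)$ is a well-defined d-tableau with the same content as $S$, and for every d-tableau $T$, $\mathtt{Dtableau2Carray}(T)$ is a well-defined c-array with the same content as $T$. Moreover, for any c-array $S$ and any d-tableau $T$, $$\mathtt{Carray2Dtableau}(S)=T\iff\mathtt{Dtableau2Carray}(T)=S.$$
   Context: A c-array is a two-rowed array of positive integers $S=\begin{bmatrix}a_1&\ldots&a_m\\ b_1&\ldots&b_m\end{bmatrix}$ with $a_i>b_i$ for all $i$ and $(a_i,b_i)\le(a_{i+1},b_{i+1})$ in the lexicographic order for all $i$. A tableau of shape $\lambda=(\lambda_1,\ldots,\lambda_r)$ (a partition) is an array of positive integers $T=(t_{ij})$, $1\le i\le r$, $1\le j\le\lambda_i$; $R_i$ denotes its $i$-th row. It is semistandard if $t_{ij}\le t_{i,j+1}$ and $t_{ij}<t_{i+1,j}$ whenever defined (weakly increasing along rows, strictly increasing down columns). A d-tableau is a semistandard tableau whose shape is a partition of an even integer $2m$ of the form $(\lambda_1,\lambda_1,\lambda_2,\lambda_2,\ldots,\lambda_r,\lambda_r)$. The content of an array or tableau is the vector recording how many times each of $1,2,\ldots$ occurs in it. $\mathtt{Insert}(T,x)$ ($T$ with rows $R_1,\ldots,R_r$, possibly with trailing empty rows): add an empty row $R_{r+1}$; set $i:=1$. While $R_i$ contains an entry $>x$: let $k$ be the smallest column with $t_{ik}>x$; replace the entry $t_{ik}$ by $x$, let $x$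 be the old value of $t_{ik}$, and set $i:=i+1$. Then append $x$ at the end of $R_i$; if $i\le r$ delete the empty row $R_{r+1}$. Return $(T,i)$. $\mathtt{Delete}(T,i)$ ($T$ semistandard of shape $(\lambda_1,\ldots,\lambda_r)$, $1\le i\le r$ with $\lambda_i>\lambda_{i+1}$, where $\lambda_{r+1}=0$): add an empty row $R_0$ on top; let $x$ be the last entry of $R_i$ and delete it from $R_i$; set $h:=i-1$. While $R_h$ contains an entry $<x$: let $k$ be the largest column with $t_{hk}<x$; replace the entry $t_{hk}$ by $x$, let $x$ be the old value of $t_{hk}$, and set $h:=h-1$. Then delete the row $R_0$ and, if $R_r$ is empty, delete it. Return $(T,x)$. $\mathtt{Carray2Dtableau}(S)$: let $T$ be the tableau with $2m$ empty rows. For $k=1,2,\ldots,m$: set $(T,i):=\mathtt{Insert}(T,b_k)$, then append $a_k$ at the end of row $R_{i+1}$. Finally delete the empty rows of $T$ and return $T$. $\mathtt{Dtableau2Carray}(T)$ ($T$ a d-tableau with $2m$ entries): for $k=m,m-1,\ldots,1$: let $x=\max(T)$ be the largest entry of $T$ and let $t_{ij}$ be the occurrence of $x$ with maximal column index $j$; set $(T,y):=\mathtt{Delete}(T,i)$; set $a_k:=x$, $b_k:=y$; then delete the entry in position $(i-1,j)$ from row $R_{i-1}$, and if $R_{i-1}$ has become empty delete it. Return $S=\begin{bmatrix}a_1&\ldots&a_m\\ b_1&\ldots&b_m\end{bmatrix}$. *)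

theory Defs
  imports Main
begin

text \<open>
  Arrays are lists of columns \<open>(a, b)\<close>, tableaux are lists of rows.  Rows, columns and the row
  index computed by the insertion algorithm are numbered from 1, so row \<open>i\<close> of \<open>T\<close>
  is \<open>T ! (i - 1)\<close>.  The empty array and the empty tableau are admitted.
\<close>

type_synonym carray = "(nat \<times> nat) list"
type_synonym tableau = "nat list list"

definition lex_le :: "nat \<times> nat \<Rightarrow> nat \<times> nat \<Rightarrow> bool" where
  "lex_le p q \<longleftrightarrow> fst p < fst q \<or> fst p = fst q \<and> snd p \<le> snd q"

definition is_carray :: "carray \<Rightarrow> bool" where
  "is_carray S \<longleftrightarrow>
     (\<forall>(a, b) \<in> set S. 0 < b \<and> b < a) \<and>
     (\<forall>k. Suc k < length S \<longrightarrow> lex_le (S ! k) (S ! Suc k))"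

definition shape :: "tableau \<Rightarrow> nat list" where
  "shape T = map length T"

text \<open>The weak version allows trailing empty rows.\<close>

definition is_weak_tableau :: "tableau \<Rightarrow> bool" where
  "is_weak_tableau T \<longleftrightarrow> sorted_wrt (\<ge>) (shape T) \<and> (\<forall>R \<in> set T. \<forall>x \<in> set R. 0 < x)"

definition is_tableau :: "tableau \<Rightarrow> bool" where
  "is_tableau T \<longleftrightarrow> is_weak_tableau T \<and> [] \<notin> set T"

definition semistandard :: "tableau \<Rightarrow> bool" where
  "semistandard T \<longleftrightarrow> is_tableau T \<and>
     (\<forall>R \<in> set T. sorted R) \<and>
     (\<forall>i j. Suc i < length T \<and> j < length (T ! Suc i) \<longrightarrow> T ! i ! j < T ! Suc i ! j)"

definition is_dtableau :: "tableau \<Rightarrow> bool" where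
  "is_dtableau T \<longleftrightarrow> semistandard T \<and> (\<exists>ls. shape T = concat (map (\<lambda>l. [l, l]) ls))"

definition array_content :: "carray \<Rightarrow> nat \<Rightarrow> nat" where
  "array_content S x = count_list (map fst S @ map snd S) x"

definition tableau_content :: "tableau \<Rightarrow> nat \<Rightarrow> nat" where
  "tableau_content T x = count_list (concat T) x"

text \<open>
  All algorithms return \<open>None\<close> as soon as a step is not well-defined, i.e. when a subroutine is
  called outside its domain or a row, entry or position that is referred to does not exist (or
  is not unique).

  The loop of \<open>Insert\<close> is a recursion down the rows.  Reaching the empty list means
  arriving at the auxiliary empty row \<open>r + 1\<close>, which is kept exactly in this case.
\<close>

fun insert_rows :: "tableau \<Rightarrow> nat \<Rightarrow> tableau \<times> nat" where
  "insert_rows [] x = ([[x]], 1)"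
| "insert_rows (R # Rs) x =
     (if \<exists>y \<in> set R. x < y then
        (let k = (LEAST k. k < length R \<and> x < R ! k);
             (Rs', i) = insert_rows Rs (R ! k)
         in (R[k := x] # Rs', i + 1))
      else ((R @ [x]) # Rs, 1))"

definition Insert :: "tableau \<Rightarrow> nat \<Rightarrow> (tableau \<times> nat) option" where
  "Insert T x = (if is_weak_tableau T \<and> 0 < x then Some (insert_rows T x) else None)"

text \<open>
  In the loop of \<open>Delete\<close> the tableau carries the auxiliary empty row 0 on top, so here row \<open>h\<close>
  is \<open>T ! h\<close>; the loop always stops at row 0.
\<close>

fun delete_loop :: "nat \<Rightarrow> tableau \<Rightarrow> nat \<Rightarrow> tableau \<times> nat" where
  "delete_loop 0 T x = (T, x)"
| "delete_loop (Suc h) T x =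
     (let R = T ! Suc h in
      if \<exists>y \<in> set R. y < x then
        (let k = (GREATEST k. k < length R \<and> R ! k < x)
         in delete_loop h (T[Suc h := R[k := x]]) (R ! k))
      else (T, x))"

definition Delete :: "tableau \<Rightarrow> nat \<Rightarrow> (tableau \<times> nat) option" where
  "Delete T i =
     (if semistandard T \<and> 1 \<le> i \<and> i \<le> length T \<and>
         (i < length T \<longrightarrow> length (T ! i) < length (T ! (i - 1)))
      then
        (let T0 = [] # T;
             (T1, y) = delete_loop (i - 1) (T0[i := butlast (T0 ! i)]) (last (T0 ! i));
             T2 = tl T1
         in Some (if last T2 = [] then butlast T2 else T2, y))
      else None)"

fun carray_to_dtableau_loop :: "carray \<Rightarrow> tableau \<Rightarrow> tableau option" where
  "carray_to_dtableau_loop [] T = Some T"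
| "carray_to_dtableau_loop ((a, b) # S) T =
     (case Insert T b of
        None \<Rightarrow> None
      | Some (T', i) \<Rightarrow>
          if i + 1 \<le> length T'
          then carray_to_dtableau_loop S (T'[i := T' ! i @ [a]])  \<comment> \<open>\<open>T' ! i\<close> is row \<open>i + 1\<close>\<close>
          else None)"

definition Carray2Dtableau :: "carray \<Rightarrow> tableau option" where
  "Carray2Dtableau S =
     map_option (filter (\<lambda>R. R \<noteq> [])) (carray_to_dtableau_loop S (replicate (2 * length S) []))"

definition cells :: "tableau \<Rightarrow> (nat \<times> nat) set" where
  "cells T = {(i, j). 1 \<le> i \<and> i \<le> length T \<and> 1 \<le> j \<and> j \<le> length (T ! (i - 1))}"

definition entry :: "tableau \<Rightarrow> nat \<times> nat \<Rightarrow> nat" where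
  "entry T c = T ! (fst c - 1) ! (snd c - 1)"

definition max_entry :: "tableau \<Rightarrow> nat" where
  "max_entry T = Max (set (concat T))"

definition is_rightmost_max :: "tableau \<Rightarrow> nat \<times> nat \<Rightarrow> bool" where
  "is_rightmost_max T c \<longleftrightarrow> c \<in> cells T \<and> entry T c = max_entry T \<and>
     (\<forall>c' \<in> cells T. entry T c' = max_entry T \<longrightarrow> snd c' \<le> snd c)"

definition delete_nth :: "nat \<Rightarrow> 'a list \<Rightarrow> 'a list" where
  "delete_nth n xs = take n xs @ drop (Suc n) xs"

definition delete_cell :: "tableau \<Rightarrow> nat \<times> nat \<Rightarrow> tableau" where
  "delete_cell T c =
     (let h = fst c - 1; R = delete_nth (snd c - 1) (T ! h)
      in if R = [] then delete_nth h T else T[h := R])"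

text \<open>The first argument is the number of columns still to be produced, from right to left.\<close>

fun dtableau_to_carray_loop :: "nat \<Rightarrow> tableau \<Rightarrow> carray option" where
  "dtableau_to_carray_loop 0 T = Some []"
| "dtableau_to_carray_loop (Suc k) T =
     (if concat T \<noteq> [] \<and> (\<exists>!c. is_rightmost_max T c) then
        (let x = max_entry T; (i, j) = (THE c. is_rightmost_max T c) in
         case Delete T i of
           None \<Rightarrow> None
         | Some (T', y) \<Rightarrow>
             if (i - 1, j) \<in> cells T'
             then map_option (\<lambda>S. S @ [(x, y)])
                    (dtableau_to_carray_loop k (delete_cell T' (i - 1, j)))
             else None)
      else None)"

definition Dtableau2Carray :: "tableau \<Rightarrow> carray option" where
  "Dtableau2Carray T = dtableau_to_carray_loop (length (concat T) div 2) T"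

end

theory Submission
  imports Defs "HOL-Library.Multiset"
begin

text \<open>
  Both algorithms are driven by one symmetric relation, so that neither has to be inverted
  explicitly.  When \<open>x\<close> bumps \<open>y\<close> out of a weakly increasing row, the row is \<open>K @ y # L\<close>
  before and \<open>K @ x # L\<close> after, with \<open>K \<le> x < y \<le> L\<close>.  Read forwards this is one
  pass through the loop of \<open>Insert\<close>, read backwards one pass through the loop of
  \<open>Delete\<close> (\<open>row_bump\<close>).  Chaining it down the rows gives bumping paths (\<open>bumps\<close>).

  One round of either algorithm is then the relation \<open>grow P (a, b) T\<close>: a path for \<open>b\<close> runs
  through the rows \<open>A\<close> of \<open>P\<close> and ends in a cell appended to the next row \<open>U\<close>, and \<open>a\<close> is
  appended to the row \<open>V\<close> below, which has the same length as \<open>U\<close>.  The relation demands in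
  addition that all entries are at most \<open>a\<close> and that \<open>a\<close> occurs neither in \<open>A\<close> nor in \<open>U\<close>.
  This side condition says exactly that the new \<open>a\<close> is the rightmost maximum of \<open>T\<close>: in a
  column strict tableau the occurrences of the maximum are at the bottom of their columns, so
  the rightmost one is the one in the topmost row.  In \<open>Dtableau2Carray\<close> the maximum \<open>a\<close> is
  pushed one row up by the first pass of \<open>Delete\<close>, replacing the last entry \<open>u\<close> of that row,
  and is then removed; the net effect is to delete the bottom two cells of the last column of
  that pair of rows and to send \<open>u\<close> back along the bumping path.

  Since column strictness is equivalent before and after a path (\<open>above_row_bump\<close> and
  \<open>above_row_bump_append\<close>), \<open>P\<close> is a d-tableau if and only if \<open>T\<close> is.  Going down, every
  nonempty d-tableau \<open>T\<close> arises from some \<open>P\<close> (\<open>grow_ex_lower\<close>).  Going up, \<open>P\<close> can grow by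
  \<open>(a, b)\<close> as soon as \<open>a\<close> is avoided by the path, and this is where the lexicographic order
  enters.  If \<open>P\<close> itself came from a pair \<open>(a, b')\<close> with the same \<open>a\<close>, then by the row
  bumping lemma (\<open>bumps_twice\<close>) the path of \<open>b\<close> ends no lower than the path of \<open>b'\<close> if and
  only if \<open>b' \<le> b\<close>; the rows down to the end of the earlier path contain no \<open>a\<close>, while the
  row after it does.  Hence successive growth steps are precisely those whose pairs increase
  lexicographically (\<open>grow_lex_le\<close> and \<open>builds_grow_ex\<close>).

  Thus c-arrays and d-tableaux are both in correspondence with histories of growth steps
  starting at the empty tableau (\<open>builds\<close>); one algorithm runs along such a history
  forwards, the other one backwards.
\<close>

section \<open>Bumping in a single row\<close>

text \<open>
  The conditions are stated so that they express at once that \<open>R\<close> is sorted with \<open>y\<close> its first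
  entry above \<open>x\<close>, and that \<open>R'\<close> is sorted with \<open>x\<close> its last entry below \<open>y\<close>.
\<close>

definition row_bump :: "nat list \<Rightarrow> nat \<Rightarrow> nat list \<Rightarrow> nat \<Rightarrow> bool" where
  "row_bump R x R' y \<longleftrightarrow>
     (\<exists>K L. R = K @ y # L \<and> R' = K @ x # L \<and> x < y \<and> sorted K \<and> sorted L \<and>
            (\<forall>z \<in> set K. z \<le> x) \<and> (\<forall>z \<in> set L. y \<le> z))"

lemma row_bump_ex_insert:
  assumes "sorted R" "\<exists>y \<in> set R. x < y"
  shows "\<exists>R' y. row_bump R x R' y"
proof -
  obtain K y L where R: "R = K @ y # L" and y: "x < y" and K: "\<forall>z \<in> set K. \<not> x < z"
    using split_list_first_prop[of R "\<lambda>z. x < z"] assms(2) by blast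
  have "row_bump R x (K @ x # L) y"
    unfolding row_bump_def using R y K assms(1)
    by (intro exI[of _ K] exI[of _ L]) (auto simp: sorted_append)
  then show ?thesis by blast
qed

lemma row_bump_ex_delete:
  assumes "sorted R'" "\<exists>x \<in> set R'. x < y"
  shows "\<exists>R x. row_bump R x R' y"
proof -
  obtain K x L where R: "R' = K @ x # L" and y: "x < y" and K: "\<forall>z \<in> set L. \<not> z < y"
    using split_list_last_prop[of R' "\<lambda>z. z < y"] assms(2) by blast
  have "row_bump (K @ y # L) x R' y"
    unfolding row_bump_def using R y K assms(1)
    by (intro exI[of _ K] exI[of _ L]) (auto simp: sorted_append)
  then show ?thesis by blast
qed

lemma row_bumpD:
  assumes "row_bump R x R' y"
  shows "x < y" "x \<in> set R'" "y \<in> set R" "sorted R" "sorted R'" "length R' = length R"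
    "add_mset x (mset R) = add_mset y (mset R')"
  using assms unfolding row_bump_def by (fastforce simp: sorted_append)+

lemma insert_rows_row_bump:
  assumes "row_bump R x R' y"
  shows "insert_rows (R # Rs) x = (let (Rs', i) = insert_rows Rs y in (R' # Rs', i + 1))"
proof -
  obtain K L where R: "R = K @ y # L" "R' = K @ x # L" and xy: "x < y" and K: "\<forall>z \<in> set K. z \<le> x"
    using assms unfolding row_bump_def by blast
  have "(LEAST k. k < length R \<and> x < R ! k) = length K"
  proof (rule Least_equality)
    fix k assume k: "k < length R \<and> x < R ! k"
    show "length K \<le> k"
    proof (rule ccontr)
      assume "\<not> length K \<le> k"
      then have "R ! k \<in> set K" using R by (simp add: nth_append)
      then show False using K k by fastforce
    qed
  qed (use R xy in auto)
  then show ?thesis using R xy by (auto simp: Let_def)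
qed

lemma delete_loop_row_bump:
  assumes "row_bump R x R' y" "length D = Suc h"
  shows "delete_loop (Suc h) (D @ R' # Q) y = delete_loop h (D @ R # Q) x"
proof -
  obtain K L where R: "R = K @ y # L" "R' = K @ x # L" and xy: "x < y" and L: "\<forall>z \<in> set L. y \<le> z"
    using assms unfolding row_bump_def by blast
  have "(GREATEST k. k < length R' \<and> R' ! k < y) = length K"
  proof (rule Greatest_equality)
    fix k assume k: "k < length R' \<and> R' ! k < y"
    show "k \<le> length K"
    proof (rule ccontr)
      assume "\<not> k \<le> length K"
      then have "R' ! k \<in> set L" using R k by (auto simp: nth_append nth_Cons split: nat.splits)
      then show False using L k by fastforce
    qed
  qed (use R xy in auto)
  then show ?thesis using R xy assms(2)
    by (auto simp: Let_def nth_append list_update_append)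
qed

text \<open>
  The one-row case of the row bumping lemma: if \<open>x \<le> x'\<close>, the second bump happens strictly to
  the right of the cell now holding \<open>x\<close>, where all entries are at least \<open>y\<close>; otherwise it
  happens at this cell or to its left, where all entries are at most \<open>x < y\<close>.
\<close>

lemma row_bump_twice:
  assumes "row_bump R x R' y" "row_bump R' x' R'' y'"
  shows "y \<le> y' \<longleftrightarrow> x \<le> x'"
proof -
  obtain K L where 1: "R' = K @ x # L" "x < y" "\<forall>z \<in> set K. z \<le> x" "\<forall>z \<in> set L. y \<le> z"
    using assms(1) unfolding row_bump_def by blast
  obtain K2 L2 where 2: "R' = K2 @ y' # L2" "x' < y'" "\<forall>z \<in> set K2. z \<le> x'" "\<forall>z \<in> set L2. y' \<le> z"
    using assms(2) unfolding row_bump_def by blast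
  have "y' \<in> set K \<union> {x} \<union> set L" "x \<in> set K2 \<union> {y'} \<union> set L2"
    using arg_cong[OF 1(1), of set] arg_cong[OF 2(1), of set] by auto
  then show ?thesis using 1 2 by fastforce
qed

section \<open>Column strictness\<close>

definition above :: "nat list \<Rightarrow> nat list \<Rightarrow> bool" where
  "above R S \<longleftrightarrow> length S \<le> length R \<and> (\<forall>j < length S. R ! j < S ! j)"

lemma transp_above: "transp above"
  unfolding transp_def above_def by (meson dual_order.trans less_le_trans less_trans)

text \<open>
  A bump at column \<open>k\<close> of the upper row, followed by a bump of the displaced entry at column
  \<open>m\<close> of the lower row, has \<open>m \<le> k\<close> by column strictness on either side of the equivalence:
  the path moves weakly to the left.  Given this, only the columns \<open>m\<close> and \<open>k\<close> need attention.
\<close>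

lemma above_row_bump:
  assumes "row_bump R x R' y" "row_bump S y S' z"
  shows "above R S \<longleftrightarrow> above R' S'"
proof -
  obtain K L where R: "R = K @ y # L" "R' = K @ x # L" "x < y"
      "\<forall>z \<in> set K. z \<le> x" "\<forall>z \<in> set L. y \<le> z"
    using assms(1) unfolding row_bump_def by blast
  obtain M N where S: "S = M @ z # N" "S' = M @ y # N" "y < z"
      "\<forall>w \<in> set M. w \<le> y" "\<forall>w \<in> set N. z \<le> w"
    using assms(2) unfolding row_bump_def by blast
  have K: "K ! j < y" if "j < length K" for j
    using R(3,4) that by (meson le_less_trans nth_mem)
  have L: "y \<le> L ! j" if "j < length L" for j using R(5) that by simp
  have M: "M ! j \<le> y" if "j < length M" for j using S(4) that by simp
  have N: "y < N ! j" if "j < length N" for j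
    using S(3,5) that by (meson less_le_trans nth_mem)
  show ?thesis
  proof
    assume *: "above R S"
    have MK: "length M \<le> length K"
    proof (rule ccontr)
      assume "\<not> length M \<le> length K"
      then show False using * M[of "length K"] R(1) S(1)
        unfolding above_def by (auto simp: nth_append dest!: spec[of _ "length K"])
    qed
    have "R' ! j < S' ! j" if j: "j < length S'" for j
    proof -
      have RS: "R ! j < S ! j" using * j S unfolding above_def by simp
      show ?thesis
      proof (cases "j = length M")
        case True
        then show ?thesis using MK K[of j] R S by (auto simp: nth_append)
      next
        case False
        then show ?thesis using RS R S by (cases "j = length K") (auto simp: nth_append nth_Cons')
      qed
    qed
    then show "above R' S'" using * R S unfolding above_def by auto
  next
    assume *: "above R' S'"
    have MR: "length M < length R'" "R' ! length M < y"
      using * S(2) unfolding above_def by (auto dest!: spec[of _ "length M"])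
    have MK: "length M \<le> length K"
    proof (rule ccontr)
      assume *: "\<not> length M \<le> length K"
      then have "length M - Suc (length K) < length L" using MR(1) R(2) by auto
      from L[OF this] show False using * MR(2) R(2) by (simp add: nth_append nth_Cons')
    qed
    have "R ! j < S ! j" if j: "j < length S" for j
    proof -
      have RS: "R' ! j < S' ! j" using * j S unfolding above_def by simp
      show ?thesis
      proof (cases "j = length M")
        case True
        then show ?thesis using MK K[of j] R S by (auto simp: nth_append)
      next
        case False
        then show ?thesis using RS R S MK j N[of "j - Suc (length M)"]
          by (cases "j = length K") (auto simp: nth_append nth_Cons')
      qed
    qed
    then show "above R S" using * R S unfolding above_def by auto
  qed
qed

text \<open>
  The same comparison where the path ends in the lower row; the new cell at the end of \<open>U\<close>
  plays the role of column \<open>m\<close>.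
\<close>

lemma above_row_bump_append:
  assumes "row_bump R x R' y" "\<forall>z \<in> set U. z \<le> y"
  shows "above R U \<longleftrightarrow> above R' (U @ [y])"
proof -
  obtain K L where R: "R = K @ y # L" "R' = K @ x # L" "x < y"
      "\<forall>z \<in> set K. z \<le> x" "\<forall>z \<in> set L. y \<le> z"
    using assms(1) unfolding row_bump_def by blast
  have K: "K ! j < y" if "j < length K" for j
    using R(3,4) that by (meson le_less_trans nth_mem)
  have L: "y \<le> L ! j" if "j < length L" for j using R(5) that by simp
  have U: "U ! j \<le> y" if "j < length U" for j using assms(2) that by simp
  show ?thesis
  proof
    assume *: "above R U"
    have UK: "length U \<le> length K"
    proof (rule ccontr)
      assume "\<not> length U \<le> length K"
      then show False using * U[of "length K"] R(1)
        unfolding above_def by (auto simp: nth_append dest!: spec[of _ "length K"])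
    qed
    have "R' ! j < (U @ [y]) ! j" if "j < length (U @ [y])" for j
    proof (cases "j < length U")
      case True
      then show ?thesis using * R UK unfolding above_def by (auto simp: nth_append)
    next
      case False
      then have "j = length U" using that by simp
      then show ?thesis using UK K[of j] R by (auto simp: nth_append)
    qed
    then show "above R' (U @ [y])" using UK R unfolding above_def by auto
  next
    assume *: "above R' (U @ [y])"
    have UR: "length U < length R'" "R' ! length U < y"
      using * unfolding above_def by (auto dest!: spec[of _ "length U"])
    have UK: "length U \<le> length K"
    proof (rule ccontr)
      assume *: "\<not> length U \<le> length K"
      then have "length U - Suc (length K) < length L" using UR(1) R(2) by auto
      from L[OF this] show False using * UR(2) R(2) by (simp add: nth_append nth_Cons')
    qed
    have "R ! j < U ! j" if "j < length U" for j
    proof -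
      have "R' ! j < (U @ [y]) ! j" using * that unfolding above_def by simp
      then show ?thesis using that UK R by (auto simp: nth_append)
    qed
    then show "above R U" using UK R unfolding above_def by auto
  qed
qed

lemma above_append_both:
  assumes "length U = length V" "u < a"
  shows "above (U @ [u]) (V @ [a]) \<longleftrightarrow> above U V"
  using assms unfolding above_def by (auto simp: nth_append less_Suc_eq)

text \<open>
  A row whose entries are at most \<open>a\<close> cannot reach below the cell of \<open>a\<close>.
\<close>

lemma above_append_upper:
  assumes "\<forall>z \<in> set H. z \<le> a"
  shows "above (V @ [a]) H \<longleftrightarrow> above V H"
proof
  assume *: "above (V @ [a]) H"
  have "length H \<le> length V"
  proof (rule ccontr)
    assume "\<not> length H \<le> length V"
    then have "length V < length H" by simp
    then have "a < H ! length V" using * unfolding above_def by (metis nth_append_length)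
    then show False using assms \<open>length V < length H\<close> by (meson leD nth_mem)
  qed
  then show "above V H" using * unfolding above_def by (auto simp: nth_append)
qed (auto simp: above_def nth_append)

section \<open>Bumping paths\<close>

inductive bumps :: "tableau \<Rightarrow> nat \<Rightarrow> tableau \<Rightarrow> nat \<Rightarrow> bool" where
  Nil: "bumps [] x [] x"
| Cons: "row_bump R x R' y \<Longrightarrow> bumps Rs y Rs' u \<Longrightarrow> bumps (R # Rs) x (R' # Rs') u"

inductive_cases bumps_ConsE: "bumps (R # Rs) x A' u"
inductive_cases bumps_Cons'E: "bumps A x (R' # Rs') u"

lemma bumps_le: "bumps A x A' u \<Longrightarrow> x \<le> u"
  by (induction rule: bumps.induct) (auto dest: row_bumpD(1))

lemma bumps_map_length: "bumps A x A' u \<Longrightarrow> map length A' = map length A"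
  by (induction rule: bumps.induct) (auto dest: row_bumpD(6))

lemma bumps_length: "bumps A x A' u \<Longrightarrow> length A' = length A"
  by (metis bumps_map_length length_map)

lemma bumps_sorted: "bumps A x A' u \<Longrightarrow> \<forall>R \<in> set A \<union> set A'. sorted R \<and> R \<noteq> []"
  by (induction rule: bumps.induct) (auto dest: row_bumpD)

lemma bumps_mset:
  "bumps A x A' u \<Longrightarrow> add_mset x (mset (concat A)) = add_mset u (mset (concat A'))"
proof (induction rule: bumps.induct)
  case (Cons R x R' y Rs Rs' u)
  have "add_mset y (add_mset x (mset (concat (R # Rs)))) =
        add_mset x (mset R) + add_mset y (mset (concat Rs))" by simp
  also have "\<dots> = add_mset y (mset R') + add_mset u (mset (concat Rs'))"
    using row_bumpD(7)[OF Cons.hyps(1)] Cons.IH by simp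
  finally show ?case by simp
qed simp

lemma bumps_set:
  assumes "bumps A x A' u"
  shows "insert x (set (concat A)) = insert u (set (concat A'))"
  using arg_cong[OF bumps_mset[OF assms], of set_mset] by simp

lemma insert_rows_bumps:
  "bumps A x A' u \<Longrightarrow> \<forall>z \<in> set U. z \<le> u \<Longrightarrow>
     insert_rows (A @ U # Q) x = (A' @ (U @ [u]) # Q, length A + 1)"
proof (induction rule: bumps.induct)
  case (Nil x)
  then show ?case by auto
next
  case (Cons R x R' y Rs Rs' u)
  then show ?case using insert_rows_row_bump[OF Cons.hyps(1)] by simp
qed

text \<open>
  The loop of \<open>Delete\<close> starts at the bottom of the path, whereas \<open>bumps\<close> is built from its
  top; therefore the rows \<open>D\<close> already passed on the way down, auxiliary row included, are kept
  general.
\<close>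

lemma delete_loop_bumps:
  "bumps A x A' u \<Longrightarrow> length D = Suc h \<Longrightarrow>
     delete_loop (h + length A') (D @ A' @ Q) u = delete_loop h (D @ A @ Q) x"
proof (induction arbitrary: D h rule: bumps.induct)
  case (Cons R x R' y Rs Rs' u)
  from Cons.IH[of "D @ [R']" "Suc h"] Cons.prems
  have "delete_loop (h + length (R' # Rs')) (D @ (R' # Rs') @ Q) u
        = delete_loop (Suc h) (D @ R' # Rs @ Q) y" by simp
  also have "\<dots> = delete_loop h (D @ R # Rs @ Q) x"
    by (rule delete_loop_row_bump[OF Cons.hyps(1) Cons.prems])
  finally show ?case by simp
qed simp

text \<open>
  An empty row guarantees that the insertion stops inside the given rows.
\<close>

lemma bumps_ex_insert:
  assumes "\<forall>R \<in> set P. sorted R" "[] \<in> set P"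
  shows "\<exists>A U Q A' u. P = A @ U # Q \<and> bumps A x A' u \<and> (\<forall>z \<in> set U. z \<le> u)"
  using assms
proof (induction P arbitrary: x)
  case (Cons R P)
  show ?case
  proof (cases "\<exists>y \<in> set R. x < y")
    case True
    then obtain R' y where b: "row_bump R x R' y"
      using row_bump_ex_insert Cons.prems(1) by (metis list.set_intros(1))
    have "[] \<in> set P" using Cons.prems(2) True by auto
    then obtain A U Q A' u where "P = A @ U # Q" "bumps A y A' u" "\<forall>z \<in> set U. z \<le> u"
      using Cons.IH[of y] Cons.prems(1) by auto
    then have "R # P = (R # A) @ U # Q" "bumps (R # A) x (R' # A') u" "\<forall>z \<in> set U. z \<le> u"
      using b by (auto intro: bumps.intros)
    then show ?thesis by blast
  next
    case False
    then have "R # P = [] @ R # P" "bumps [] x [] x" "\<forall>z \<in> set R. z \<le> x"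
      by (auto intro: bumps.intros)
    then show ?thesis by blast
  qed
qed simp

text \<open>
  Upwards the path never gets stuck: the entry leaving a row has a smaller entry above it in
  its column.
\<close>

lemma bumps_ex_delete:
  assumes "\<forall>R \<in> set A'. sorted R" "successively above (A' @ [U @ [u]])"
  shows "\<exists>A x. bumps A x A' u"
  using assms
proof (induction A')
  case Nil
  then show ?case using bumps.Nil by blast
next
  case (Cons R' A')
  have "successively above (A' @ [U @ [u]])" using Cons.prems(2) by (cases A') auto
  then obtain A y where A: "bumps A y A' u" using Cons by auto
  have "\<exists>H. above R' H \<and> y \<in> set H"
  proof (cases A')
    case Nil
    then have "y = u" using A by (auto elim: bumps.cases)
    then show ?thesis using Nil Cons.prems(2) by auto
  next
    case (Cons S' B)
    then have "y \<in> set S'" using A by (auto elim!: bumps_Cons'E dest: row_bumpD(2))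
    then show ?thesis using Cons Cons.prems(2) by auto
  qed
  then have "\<exists>x \<in> set R'. x < y"
    unfolding above_def by (metis in_set_conv_nth nth_mem order.strict_trans2)
  then show ?case
    using row_bump_ex_delete[of R' y] Cons.prems(1) A bumps.Cons by (metis list.set_intros(1))
qed

lemma successively_above_bumps:
  "bumps A x A' u \<Longrightarrow> \<forall>z \<in> set U. z \<le> u \<Longrightarrow>
     successively above (A @ [U]) \<longleftrightarrow> successively above (A' @ [U @ [u]])"
proof (induction rule: bumps.induct)
  case (Cons R x R' y Rs Rs' u)
  show ?case
  proof (cases Rs)
    case Nil
    then have "Rs' = []" "u = y" using Cons.hyps(2) by (auto elim: bumps.cases)
    then show ?thesis using Nil above_row_bump_append[OF Cons.hyps(1)] Cons.prems by simp
  next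
    case (Cons S B)
    then obtain S' B' z where S: "Rs' = S' # B'" "row_bump S y S' z"
      using Cons.hyps(2) by (auto elim: bumps_ConsE)
    then show ?thesis
      using Cons Cons.IH[OF Cons.prems] above_row_bump[OF Cons.hyps(1) S(2)] by simp
  qed
qed simp

text \<open>
  The row bumping lemma.  Only the rows down to the end of the first path have to agree with
  its outcome; this leaves room for the entry appended below the path by the correspondence.
\<close>

lemma bumps_twice:
  assumes "bumps A1 x1 A1' u1" "\<forall>z \<in> set U1. z \<le> u1"
    and "bumps A2 x2 A2' u2" "\<forall>z \<in> set U2. z \<le> u2"
    and "A1' @ (U1 @ [u1]) # Q1 = A2 @ U2 # Q2"
  shows "length A2 \<le> length A1 \<longleftrightarrow> x1 \<le> x2"
  using assms
proof (induction arbitrary: A2 x2 A2' rule: bumps.induct)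
  case (Nil x)
  show ?case
  proof (cases A2)
    case Nil
    then show ?thesis using Nil.prems by (auto elim: bumps.cases)
  next
    case (Cons R B)
    then obtain R' y where b: "row_bump R x2 R' y"
      using Nil.prems(2) by (auto elim: bumps_ConsE)
    have "y \<in> set (U1 @ [x])" "x2 < y" using row_bumpD[OF b] Nil.prems(4) Cons by auto
    then show ?thesis using Nil.prems(1) Cons by auto
  qed
next
  case (Cons R x R' y Rs Rs' u)
  show ?case
  proof (cases A2)
    case Nil
    then show ?thesis using Cons.prems row_bumpD(2)[OF Cons.hyps(1)] by (auto elim: bumps.cases)
  next
    case (Cons S B)
    then obtain S' B' y2 where S: "row_bump S x2 S' y2" "bumps B y2 B' u2"
      using Cons.prems(2) by (auto elim: bumps_ConsE)
    have "S = R'" "Rs' @ (U1 @ [u]) # Q1 = B @ U2 # Q2" using Cons Cons.prems(4) by auto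
    then show ?thesis
      using Cons.IH[OF Cons.prems(1) S(2) Cons.prems(3)] row_bump_twice[OF Cons.hyps(1)] S(1) Cons
      by auto
  qed
qed

section \<open>D-tableaux with trailing empty rows\<close>

text \<open>
  The recursive form of the shape condition for d-tableaux; lengths zero serve the empty rows.
\<close>

fun paired :: "nat list \<Rightarrow> bool" where
  "paired [] = True"
| "paired [k] = False"
| "paired (k # l # ls) = (k = l \<and> paired ls)"

lemma paired_iff: "paired ks \<longleftrightarrow> (\<exists>ls. ks = concat (map (\<lambda>l. [l, l]) ls))"
proof
  show "paired ks \<Longrightarrow> \<exists>ls. ks = concat (map (\<lambda>l. [l, l]) ls)"
  proof (induction ks rule: paired.induct)
    case (3 k l ks)
    then obtain ls where "ks = concat (map (\<lambda>l. [l, l]) ls)" by auto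
    then show ?case using 3 by (intro exI[of _ "k # ls"]) simp
  qed auto
  have "paired (concat (map (\<lambda>l. [l, l]) ls))" for ls by (induction ls) auto
  then show "\<exists>ls. ks = concat (map (\<lambda>l. [l, l]) ls) \<Longrightarrow> paired ks" by blast
qed

lemma paired_even: "paired ks \<Longrightarrow> even (length ks)"
  by (induction ks rule: paired.induct) auto

lemma paired_even_sum: "paired ks \<Longrightarrow> even (sum_list ks)"
  by (induction ks rule: paired.induct) auto

lemma paired_filter: "paired ks \<Longrightarrow> paired (filter Q ks)"
  by (induction ks rule: paired.induct) auto

lemma paired_replicate: "even n \<Longrightarrow> paired (replicate n k)"
proof -
  have "paired (replicate (2 * m) k)" for m by (induction m) auto
  then show "even n \<Longrightarrow> paired (replicate n k)" by (auto elim: evenE)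
qed

lemma paired_append: "even (length ks) \<Longrightarrow> paired (ks @ ls) \<longleftrightarrow> paired ks \<and> paired ls"
  by (induction ks rule: paired.induct) auto

text \<open>
  A row preceded by an odd number of rows is the second one of its pair.
\<close>

lemma paired_odd:
  assumes "odd (length ks)" "paired (ks @ l # ls)"
  shows "\<exists>ks'. ks = ks' @ [l]"
proof -
  obtain ks' k where "ks = ks' @ [k]" using assms(1) by (cases ks rule: rev_cases) auto
  then show ?thesis using assms paired_append[of ks' "k # l # ls"] by auto
qed

text \<open>
  D-tableaux that may have empty rows at the end, as in the loop of \<open>Carray2Dtableau\<close>.  With
  enough of them \<open>Insert\<close> creates no row, and a growth step and its reversal keep the number
  of rows; the rows that \<open>Dtableau2Carray\<close> removes are accounted for by \<open>strip\<close> below.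
\<close>

definition weak_dtableau :: "tableau \<Rightarrow> bool" where
  "weak_dtableau T \<longleftrightarrow> (\<forall>R \<in> set T. sorted R \<and> (\<forall>x \<in> set R. 0 < x)) \<and>
     successively above T \<and> paired (map length T)"

lemma weak_dtableau_sorted_wrt: "weak_dtableau T \<Longrightarrow> sorted_wrt above T"
  unfolding weak_dtableau_def using successively_conv_sorted_wrt[OF transp_above] by blast

abbreviation strip :: "tableau \<Rightarrow> tableau" where
  "strip \<equiv> filter (\<lambda>R. R \<noteq> [])"

lemma above_length: "above R S \<Longrightarrow> length S \<le> length R"
  unfolding above_def by blast

lemma weak_dtableau_weak_tableau:
  assumes "weak_dtableau T"
  shows "is_weak_tableau T"
  using sorted_wrt_mono_rel[OF _ weak_dtableau_sorted_wrt[OF assms], of "\<lambda>R S. length S \<le> length R"] assms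
  unfolding is_weak_tableau_def shape_def sorted_wrt_map weak_dtableau_def by (auto simp: above_length)

lemma weak_dtableau_strip:
  assumes "weak_dtableau T"
  shows "weak_dtableau (strip T)"
proof -
  have "map length (strip T) = filter (\<lambda>k. k \<noteq> 0) (map length T)"
    by (simp add: filter_map o_def)
  then show ?thesis
    using assms sorted_wrt_filter[OF weak_dtableau_sorted_wrt[OF assms]] paired_filter
    unfolding weak_dtableau_def successively_conv_sorted_wrt[OF transp_above] by auto
qed

lemma is_dtableau_iff: "is_dtableau T \<longleftrightarrow> weak_dtableau T \<and> [] \<notin> set T"
proof
  assume v: "weak_dtableau T \<and> [] \<notin> set T"
  have "T ! i ! j < T ! Suc i ! j" if "Suc i < length T" "j < length (T ! Suc i)" for i j
    using sorted_wrt_nth_less[OF weak_dtableau_sorted_wrt, of T i "Suc i"] v that unfolding above_def by auto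
  then show "is_dtableau T"
    using v weak_dtableau_weak_tableau[of T] unfolding is_dtableau_def semistandard_def is_tableau_def
    by (auto simp: weak_dtableau_def paired_iff shape_def)
next
  assume d: "is_dtableau T"
  then have "sorted_wrt (\<lambda>R S. length S \<le> length R) T"
    unfolding is_dtableau_def semistandard_def is_tableau_def is_weak_tableau_def shape_def
      sorted_wrt_map by simp
  then have "above (T ! i) (T ! Suc i)" if "Suc i < length T" for i
    using d that sorted_wrt_nth_less[of _ T i "Suc i"]
    unfolding above_def is_dtableau_def semistandard_def by auto
  then have "successively above T" unfolding successively_conv_nth by blast
  then show "weak_dtableau T \<and> [] \<notin> set T"
    using d unfolding is_dtableau_def semistandard_def is_tableau_def is_weak_tableau_def
    by (auto simp: weak_dtableau_def paired_iff shape_def)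
qed

lemma length_le_concat: "[] \<notin> set T \<Longrightarrow> length T \<le> length (concat T)"
proof (induction T)
  case (Cons R T)
  then have "0 < length R" "length T \<le> length (concat T)" by auto
  then have "Suc (length T) \<le> length R + length (concat T)" by linarith
  then show ?case by simp
qed simp

lemma weak_dtableau_padded:
  assumes "weak_dtableau T" "even n"
  shows "weak_dtableau (T @ replicate n [])"
proof -
  have "paired (replicate n 0)" using assms(2) paired_replicate by blast
  then show ?thesis
    using assms paired_append[of "map length T" "replicate n 0"] paired_even[of "map length T"]
    unfolding weak_dtableau_def successively_conv_sorted_wrt[OF transp_above] sorted_wrt_append
    by (auto simp: above_def sorted_wrt_iff_nth_less)
qed

section \<open>One step of the correspondence\<close>

text \<open>
  One round of \<open>Carray2Dtableau\<close> from \<open>P\<close> to \<open>T\<close> and, up to empty rows, of \<open>Dtableau2Carray\<close>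
  from \<open>T\<close> to \<open>P\<close>.
  The bounds on the entries make the new \<open>a\<close> the rightmost maximum of \<open>T\<close>; the parity of \<open>A\<close>
  makes \<open>U\<close> and \<open>V\<close> one of the pairs of rows of equal length.
\<close>

inductive grow :: "tableau \<Rightarrow> nat \<times> nat \<Rightarrow> tableau \<Rightarrow> bool" where
  "grow (A @ U # V # B) (a, b) (A' @ (U @ [u]) # (V @ [a]) # B)"
  if "bumps A b A' u" "\<forall>z \<in> set U. z \<le> u" "length U = length V" "even (length A)"
     "0 < b" "b < a" "\<forall>R \<in> set A \<union> {U}. \<forall>z \<in> set R. z < a" "\<forall>R \<in> {V} \<union> set B. \<forall>z \<in> set R. z \<le> a"

text \<open>
  A path through entries smaller than \<open>a\<close> never displaces an \<open>a\<close>.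
\<close>

lemma bumps_less:
  assumes "bumps A b A' u" "b < a" "\<forall>R \<in> set A. \<forall>z \<in> set R. z < a"
  shows "u < a \<and> (\<forall>R \<in> set A'. \<forall>z \<in> set R. z < (a::nat))"
proof -
  have "\<forall>z \<in> insert b (set (concat A)). z < a" using assms by auto
  then have "\<forall>z \<in> insert u (set (concat A')). z < a" unfolding bumps_set[OF assms(1)] .
  then show ?thesis by auto
qed

lemma grow_weak_dtableau:
  assumes "grow P c T"
  shows "weak_dtableau P \<longleftrightarrow> weak_dtableau T"
  using assms
proof cases
  case (1 A b A' u U V a B)
  have u: "u < a" using bumps_less[OF 1(4,9)] 1(10) by blast
  have ne: "insert b (set (concat A)) = insert u (set (concat A'))" by (rule bumps_set[OF 1(4)])
  have "0 < u" using bumps_le[OF 1(4)] 1(8) by simp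
  then have pos: "(\<forall>R \<in> set A. \<forall>z \<in> set R. 0 < z) \<longleftrightarrow> (\<forall>R \<in> set A'. \<forall>z \<in> set R. 0 < z)"
    using ne 1(8) by (auto simp: set_eq_iff)
  have "successively above P \<longleftrightarrow> successively above (A @ [U]) \<and> above U V \<and> successively above (V # B)"
    unfolding 1 using successively_append_iff[of above "A @ [U]" "V # B"] by auto
  also have "\<dots> \<longleftrightarrow> successively above (A' @ [U @ [u]]) \<and> above (U @ [u]) (V @ [a])
                     \<and> successively above ((V @ [a]) # B)"
    using successively_above_bumps[OF 1(4,5)] above_append_both[OF 1(6) u] above_append_upper 1(11)
    by (cases B) auto
  also have "\<dots> \<longleftrightarrow> successively above T"
    unfolding 1 using successively_append_iff[of above "A' @ [U @ [u]]" "(V @ [a]) # B"] by auto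
  finally have succ: "successively above P \<longleftrightarrow> successively above T" .
  have paired: "paired (map length P) \<longleftrightarrow> paired (map length T)"
    using bumps_map_length[OF 1(4)] 1(6,7) paired_append[of "map length A"] unfolding 1 by simp
  show ?thesis unfolding weak_dtableau_def succ paired
    using 1(5,8,9,11) u \<open>0 < u\<close> pos bumps_sorted[OF 1(4)] unfolding 1(1,3)
    by (auto simp: sorted_append ball_Un)
qed

lemma grow_mset:
  assumes "grow P (a, b) T"
  shows "mset (concat T) = mset (concat P) + {#a, b#}"
  using assms by cases (auto dest!: bumps_mset simp: add.commute)

lemma grow_length: "grow P c T \<Longrightarrow> length T = length P"
  by (auto elim!: grow.cases dest: bumps_length)

lemma grow_bound:
  assumes "grow P (a, b) T"
  shows "b < a" "0 < b" "\<forall>z \<in> set (concat T). z \<le> a" "\<forall>z \<in> set (concat P). z \<le> a" "a \<in> set (concat T)"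
proof -
  show "b < a" "0 < b" "a \<in> set (concat T)" using assms by (cases, auto)+
  show "\<forall>z \<in> set (concat P). z \<le> a" using assms by cases (auto simp: less_imp_le)
  then show "\<forall>z \<in> set (concat T). z \<le> a"
    using \<open>b < a\<close> arg_cong[OF grow_mset[OF assms], of set_mset] by auto
qed

text \<open>
  Suppose both steps use the same \<open>a\<close>.  The first one puts \<open>a\<close> into the row right below the
  end of its path.  The second one must find no \<open>a\<close> in the rows of its own path, so its path
  ends no lower than the first one, and the row bumping lemma applies.
\<close>

lemma grow_lex_le:
  assumes "grow P0 c1 P" "grow P c2 T"
  shows "lex_le c1 c2"
proof -
  obtain a1 b1 a2 b2 where c: "c1 = (a1, b1)" "c2 = (a2, b2)" by fastforce
  have le: "a1 \<le> a2" using grow_bound(5) grow_bound(4) assms c by blast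
  moreover have "b1 \<le> b2" if "a1 = a2"
  proof -
    from assms(1) obtain A1 A1' u1 U1 V1 B1 where 1: "P = A1' @ (U1 @ [u1]) # (V1 @ [a1]) # B1"
      "bumps A1 b1 A1' u1" "\<forall>z \<in> set U1. z \<le> u1" unfolding c by cases auto
    from assms(2) obtain A2 A2' u2 U2 V2 B2 where 2: "P = A2 @ U2 # V2 # B2"
      "bumps A2 b2 A2' u2" "\<forall>z \<in> set U2. z \<le> u2" "\<forall>R \<in> set A2 \<union> {U2}. \<forall>z \<in> set R. z < a2"
      unfolding c by cases auto
    have "length A2 \<le> length A1"
    proof (rule ccontr)
      assume "\<not> length A2 \<le> length A1"
      then have "V1 @ [a1] \<in> set (take (length A2 + 1) P)"
        using bumps_length[OF 1(2)] unfolding 1(1) in_set_conv_nth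
        by (intro exI[of _ "length A1 + 1"]) (auto simp: nth_append)
      then show False using 2(4) that unfolding 2(1) by auto
    qed
    then show ?thesis using bumps_twice[OF 1(2,3) 2(2,3)] 1(1) 2(1) by metis
  qed
  ultimately show ?thesis unfolding lex_le_def c by auto
qed

text \<open>
  The path always ends in the first row of a pair: the row of the new cell must become longer
  without exceeding the row above it.
\<close>

lemma grow_ex_upper:
  assumes "weak_dtableau P" "[] \<in> set P" "0 < b" "b < a" "\<forall>z \<in> set (concat P). z \<le> a"
    and "\<And>A U Q A' u. P = A @ U # Q \<Longrightarrow> bumps A b A' u \<Longrightarrow> \<forall>z \<in> set U. z \<le> u \<Longrightarrow>
           \<forall>R \<in> set A \<union> {U}. \<forall>z \<in> set R. z < a"
  shows "\<exists>T. grow P (a, b) T"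
proof -
  obtain A U Q A' u where P: "P = A @ U # Q" "bumps A b A' u" "\<forall>z \<in> set U. z \<le> u"
    using bumps_ex_insert[of P b] assms(1,2) unfolding weak_dtableau_def by blast
  have "successively above (A @ [U])"
    using assms(1) unfolding weak_dtableau_def P(1) by (auto simp: successively_append_iff)
  then have ab: "successively above (A' @ [U @ [u]])" using successively_above_bumps[OF P(2,3)] by simp
  have pr: "paired (map length A @ length U # map length Q)"
    using assms(1) unfolding weak_dtableau_def P(1) by simp
  have even: "even (length A)"
  proof (rule ccontr)
    assume "odd (length A)"
    then obtain ks where "map length A' = ks @ [length U]"
      using paired_odd[OF _ pr] bumps_map_length[OF P(2)] by auto
    then obtain A0 W where "A' = A0 @ [W]" "length W = length U"
      by (cases A' rule: rev_cases) auto
    then show False using ab by (auto simp: successively_append_iff above_def)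
  qed
  then have "paired (length U # map length Q)" using pr paired_append[of "map length A"] by simp
  then obtain V B where Q: "Q = V # B" "length U = length V"
    by (cases Q) auto
  have "grow P (a, b) (A' @ (U @ [u]) # (V @ [a]) # B)"
    unfolding P(1) Q(1)
    using P(2,3) Q(2) even assms(3,4) assms(6)[OF P] assms(5) unfolding P(1) Q(1)
    by (intro grow.intros) auto
  then show ?thesis by blast
qed

text \<open>
  The step to undo is found at the topmost row that contains the maximum \<open>a\<close>, which ends in
  \<open>a\<close>.  Nothing lies below this last cell, since it would be larger than \<open>a\<close>; hence the row is
  the second one of its pair, and the entry \<open>u\<close> at the end of the row above starts the reverse
  path.
\<close>

lemma grow_ex_lower:
  assumes "weak_dtableau T" "concat T \<noteq> []"
  shows "\<exists>P c. grow P c T"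
proof -
  define a where "a = Max (set (concat T))"
  have a: "a \<in> set (concat T)" "\<forall>z \<in> set (concat T). z \<le> a"
    unfolding a_def using assms(2) by (auto simp del: set_concat intro: Max_in)
  then obtain A0 W B where T: "T = A0 @ W # B" "a \<in> set W" "\<forall>R \<in> set A0. a \<notin> set R"
    using split_list_first_prop[of T "\<lambda>R. a \<in> set R"] by auto
  have sW: "sorted W" using assms(1) unfolding weak_dtableau_def T by simp
  obtain V x where W: "W = V @ [x]" using T(2) by (cases W rule: rev_cases) auto
  have "x = a" using sW T(2) a(2) unfolding T(1) W by (auto simp: sorted_append intro: antisym)
  have pr: "paired (map length A0 @ length W # map length B)"
    using assms(1) unfolding weak_dtableau_def T(1) by simp
  have "odd (length A0)"
  proof (rule ccontr)
    assume "\<not> odd (length A0)"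
    then have "paired (length W # map length B)" using pr paired_append[of "map length A0"] by simp
    then obtain H B' where H: "B = H # B'" "length H = length W" by (cases B) auto
    have "above W H" using assms(1) unfolding weak_dtableau_def T(1) H(1) by (auto simp: successively_append_iff)
    moreover have "\<forall>z \<in> set H. z \<le> a" using a(2) unfolding T(1) H(1) by auto
    ultimately have "above V H" using above_append_upper unfolding W \<open>x = a\<close> by blast
    then show False using H(2) unfolding W above_def by auto
  qed
  then obtain ks where ks: "map length A0 = ks @ [length W]" using paired_odd[OF _ pr] by auto
  then obtain A' X where A0: "A0 = A' @ [X]" "length X = length W"
    by (cases A0 rule: rev_cases) auto
  obtain U u where X: "X = U @ [u]" using A0(2) W by (cases X rule: rev_cases) auto
  have UV: "length U = length V" using A0(2) unfolding X W by simp
  have ab: "successively above (A' @ [U @ [u]])" "\<forall>R \<in> set A'. sorted R" "sorted (U @ [u])"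
    using assms(1) unfolding weak_dtableau_def T(1) A0(1) X by (auto simp: successively_append_iff)
  obtain A b where A: "bumps A b A' u" using bumps_ex_delete[OF ab(2,1)] by blast
  have top: "\<forall>R \<in> set A' \<union> {U @ [u]}. \<forall>z \<in> set R. z < a"
    using a(2) T(3) unfolding T(1) A0(1) X by (auto simp: less_le)
  have ne: "insert b (set (concat A)) = insert u (set (concat A'))" by (rule bumps_set[OF A])
  have "\<forall>z \<in> insert u (set (concat A')). 0 < z \<and> z < a"
    using top assms(1) unfolding weak_dtableau_def T(1) A0(1) X by auto
  then have "\<forall>z \<in> insert b (set (concat A)). 0 < z \<and> z < a" unfolding ne .
  then have "grow (A @ U # V # B) (a, b) (A' @ (U @ [u]) # (V @ [a]) # B)"
    using A ab(3) UV \<open>odd (length A0)\<close> A0(1) bumps_length[OF A] top a(2)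
    unfolding T(1) W
    by (intro grow.intros) (auto simp: sorted_append)
  then show ?thesis unfolding T(1) A0(1) X W \<open>x = a\<close> by auto
qed

section \<open>The loop bodies of the two algorithms\<close>

lemma carray_to_dtableau_loop_grow:
  assumes "grow P c T" "weak_dtableau P"
  shows "carray_to_dtableau_loop (c # S) P = carray_to_dtableau_loop S T"
  using assms(1)
proof cases
  case (1 A b A' u U V a B)
  have "Insert P b = Some (A' @ (U @ [u]) # V # B, length A + 1)"
    unfolding Insert_def 1(1) using weak_dtableau_weak_tableau[OF assms(2)] 1(1,8)
      insert_rows_bumps[OF 1(4,5)] by simp
  then show ?thesis
    using bumps_length[OF 1(4)] unfolding 1(2,3)
    by (simp add: nth_append list_update_append)
qed

text \<open>
  Uniqueness of the cell that \<open>Dtableau2Carray\<close> selects: rows above contain no maximum, and rows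
  below are too short to reach this column.
\<close>

lemma rightmost_max_iff:
  assumes "T = A @ (V @ [a]) # B" "\<forall>R \<in> set A. \<forall>z \<in> set R. z < a" "\<forall>R \<in> set B. \<forall>z \<in> set R. z \<le> a"
    "\<forall>z \<in> set V. z \<le> a" "sorted_wrt above T"
  shows "is_rightmost_max T c \<longleftrightarrow> c = (length A + 1, length V + 1)"
proof -
  have B: "length R \<le> length V" if "R \<in> set B" for R
  proof -
    have "above (V @ [a]) R" "\<forall>z \<in> set R. z \<le> a"
      using assms(3,5) that unfolding assms(1) sorted_wrt_append by auto
    then show ?thesis using above_append_upper above_length by blast
  qed
  have max: "max_entry T = a"
    unfolding max_entry_def using assms(1-4) by (intro Max_eqI) (auto simp: less_imp_le)
  let ?c = "(length A + 1, length V + 1)"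
  have c: "?c \<in> cells T" "entry T ?c = a" unfolding cells_def entry_def assms(1) by auto
  have less: "c' = ?c \<or> snd c' < snd ?c" if c': "c' \<in> cells T" "entry T c' = a" for c'
  proof -
    obtain i j where ij: "c' = (Suc i, Suc j)" "i < length T" "j < length (T ! i)" "T ! i ! j = a"
      using c' unfolding cells_def entry_def
      by (cases c'; cases "fst c'"; cases "snd c'") auto
    have "\<not> i < length A"
    proof
      assume "i < length A"
      then have "T ! i \<in> set A" unfolding assms(1) by (simp add: nth_append)
      then show False using ij(3,4) assms(2) nth_mem by blast
    qed
    then consider "i = length A" | "T ! i \<in> set B"
      using ij(2) unfolding assms(1) by (force simp: nth_append nth_Cons')
    then show ?thesis
    proof cases
      case 1
      then show ?thesis using ij unfolding assms(1) by auto
    next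
      case 2
      then show ?thesis using B[OF 2] ij by auto
    qed
  qed
  show ?thesis
  proof
    assume r: "is_rightmost_max T c"
    then have "snd ?c \<le> snd c" using c max unfolding is_rightmost_max_def by metis
    then show "c = ?c" using less[of c] r max unfolding is_rightmost_max_def by fastforce
  next
    assume "c = ?c"
    then show "is_rightmost_max T c"
      unfolding is_rightmost_max_def using c less max by fastforce
  qed
qed

text \<open>
  The first pass of \<open>Delete\<close> always exchanges the removed maximum \<open>a\<close> with the entry \<open>u\<close> at the
  end of the row above, and the subsequent deletion of a cell removes this \<open>a\<close>.  The remaining
  passes follow the path of the growth step backwards.
\<close>

lemma dtableau_to_carray_loop_grow:
  assumes "grow P c T" "weak_dtableau P"
  shows "dtableau_to_carray_loop (Suc k) (strip T) =
         map_option (\<lambda>S. S @ [c]) (dtableau_to_carray_loop k (strip P))"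
  using assms(1)
proof cases
  case (1 A b A' u U V a B)
  let ?B = "strip B" and ?T = "strip T"
  have vT: "weak_dtableau T" using grow_weak_dtableau[OF assms(1)] assms(2) by simp
  have ne: "\<forall>R \<in> set A \<union> set A'. R \<noteq> []" using bumps_sorted[OF 1(4)] by blast
  then have fA: "strip A = A" "strip A' = A'" by (auto simp: filter_id_conv)
  have T: "?T = A' @ (U @ [u]) # (V @ [a]) # ?B" using fA unfolding 1(3) by simp
  have P: "strip P = (if U = [] then A @ ?B else A @ U # V # ?B)" using fA 1(6) unfolding 1(1) by auto
  have ss: "semistandard ?T"
    using weak_dtableau_strip[OF vT] is_dtableau_iff[of ?T] unfolding is_dtableau_def by auto
  have sw: "sorted_wrt above ?T" by (rule weak_dtableau_sorted_wrt[OF weak_dtableau_strip[OF vT]])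
  have u: "u < a" "\<forall>R \<in> set A'. \<forall>z \<in> set R. z < a" using bumps_less[OF 1(4,9)] 1(10) by auto
  have lA: "length A' = length A" by (rule bumps_length[OF 1(4)])
  have R: "is_rightmost_max ?T c' \<longleftrightarrow> c' = (length A + 2, length V + 1)" for c'
  proof -
    have "\<forall>R \<in> set (A' @ [U @ [u]]). \<forall>z \<in> set R. z < a" "\<forall>R \<in> set ?B. \<forall>z \<in> set R. z \<le> a"
      "\<forall>z \<in> set V. z \<le> a" "?T = (A' @ [U @ [u]]) @ (V @ [a]) # ?B"
      using u 1(10,11) T by auto
    then show ?thesis using rightmost_max_iff[of ?T "A' @ [U @ [u]]" V a ?B c'] sw lA by simp
  qed
  have max: "max_entry ?T = a"
    using R[of "(length A + 2, length V + 1)"] lA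
    unfolding is_rightmost_max_def entry_def T by (auto simp: nth_append)
  have lenB: "\<forall>R \<in> set ?B. length R \<le> length V"
  proof
    fix R assume R: "R \<in> set ?B"
    then have "above (V @ [a]) R" "\<forall>z \<in> set R. z \<le> a"
      using sw 1(11) unfolding T sorted_wrt_append by auto
    then show "length R \<le> length V" using above_append_upper above_length by blast
  qed
  \<comment> \<open>\<open>Delete\<close> drops an emptied row only if it is the last one\<close>
  have VB: "V = [] \<Longrightarrow> ?B = []" using lenB by (auto simp: filter_empty_conv)
  have sU: "sorted U" using assms(2) unfolding weak_dtableau_def 1(1) by simp
  \<comment> \<open>the first pass of the loop, in the row above the maximum\<close>
  have "row_bump (U @ [a]) u (U @ [u]) a"
    unfolding row_bump_def using u(1) sU 1(5) by (intro exI[of _ U] exI[of _ "[]"]) auto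
  from delete_loop_row_bump[OF this, of "[] # A'" "length A'" "V # ?B"]
    delete_loop_bumps[OF 1(4), of "[[]]" 0 "(U @ [a]) # V # ?B"]
  have loop: "delete_loop (Suc (length A)) ([] # A' @ (U @ [u]) # V # ?B) a
        = ([] # A @ (U @ [a]) # V # ?B, b)" using lA by simp
  let ?T' = "A @ (U @ [a]) # (if V = [] then [] else V # ?B)"
  let ?i = "length A + 2"
  have row: "([] # ?T) ! ?i = V @ [a]" and upd: "([] # ?T)[?i := V] = [] # A' @ (U @ [u]) # V # ?B"
    unfolding T using lA by (simp_all add: nth_append list_update_append)
  have corner: "length (?T ! ?i) < length (?T ! (?i - 1))" if "?i < length ?T"
    using that lenB lA unfolding T by (cases ?B) (auto simp: nth_append)
  have last: "(if last (A @ (U @ [a]) # V # ?B) = [] then butlast (A @ (U @ [a]) # V # ?B)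
               else A @ (U @ [a]) # V # ?B) = ?T'"
  proof (cases "V = []")
    case True
    then show ?thesis using VB by (simp add: butlast_append)
  next
    case False
    then have "last (V # ?B) \<noteq> []" using last_in_set[of ?B] by auto
    then show ?thesis using False by simp
  qed
  have "?i \<le> length ?T" unfolding T using lA by simp
  then have "Delete ?T ?i = Some (let (T1, y) = delete_loop (?i - 1) (([] # ?T)[?i := V]) a;
      T2 = tl T1 in (if last T2 = [] then butlast T2 else T2, y))"
    unfolding Delete_def Let_def row using ss corner by (simp add: case_prod_unfold)
  also have "?i - 1 = Suc (length A)" by simp
  finally have del: "Delete ?T ?i = Some (?T', b)"
    unfolding upd loop Let_def prod.case list.sel last .
  have cell: "(length A + 1, length V + 1) \<in> cells ?T'"
    unfolding cells_def using 1(6) by auto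
  have dc: "delete_cell ?T' (length A + 1, length V + 1) = strip P"
    unfolding delete_cell_def delete_nth_def P using 1(6) VB by (auto simp: Let_def nth_append list_update_append)
  have "concat ?T \<noteq> []" unfolding T by simp
  moreover have "\<exists>!c. is_rightmost_max ?T c" "(THE c. is_rightmost_max ?T c) = (?i, length V + 1)"
    unfolding R by auto
  ultimately show ?thesis using del cell dc max unfolding 1(2) by simp
qed

section \<open>Histories of growth steps\<close>

text \<open>
  The parameter is the number of rows, which stays constant by means of empty rows.
\<close>

inductive builds :: "nat \<Rightarrow> carray \<Rightarrow> tableau \<Rightarrow> bool" for N where
  Nil: "even N \<Longrightarrow> builds N [] (replicate N [])"
| Snoc: "builds N S P \<Longrightarrow> grow P c T \<Longrightarrow> builds N (S @ [c]) T"

lemma weak_dtableau_empty: "even N \<Longrightarrow> weak_dtableau (replicate N [])"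
  using weak_dtableau_padded[of "[]" N] by (simp add: weak_dtableau_def)

lemma builds_weak_dtableau: "builds N S T \<Longrightarrow> weak_dtableau T \<and> length T = N"
  by (induction rule: builds.induct) (auto simp: weak_dtableau_empty grow_length dest: grow_weak_dtableau)

lemma builds_mset: "builds N S T \<Longrightarrow> mset (concat T) = mset (map fst S @ map snd S)"
proof (induction rule: builds.induct)
  case (Snoc S P c T)
  then show ?case using grow_mset[of P "fst c" "snd c" T] by simp
qed (auto simp: concat_replicate_trivial)

lemma builds_size: "builds N S T \<Longrightarrow> length (concat T) = 2 * length S"
  using arg_cong[OF builds_mset, of N S T size] by simp

lemma builds_content: "builds N S T \<Longrightarrow> tableau_content (strip T) = array_content S"
proof -
  assume b: "builds N S T"
  have "concat (strip T) = concat T" by (induction T) auto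
  then show ?thesis
    using builds_mset[OF b] unfolding tableau_content_def array_content_def
    by (simp add: fun_eq_iff flip: count_mset)
qed

lemma builds_carray_loop:
  "builds N S T \<Longrightarrow> carray_to_dtableau_loop (S @ S') (replicate N []) = carray_to_dtableau_loop S' T"
proof (induction arbitrary: S' rule: builds.induct)
  case (Snoc S P c T)
  then show ?case
    using Snoc.IH[of "c # S'"] carray_to_dtableau_loop_grow[OF Snoc.hyps(2)] builds_weak_dtableau by simp
qed simp

lemma builds_dtableau_loop:
  "builds N S T \<Longrightarrow> dtableau_to_carray_loop (length S) (strip T) = Some S"
proof (induction rule: builds.induct)
  case (Snoc S P c T)
  then show ?case
    using dtableau_to_carray_loop_grow[OF Snoc.hyps(2), of "length S"] builds_weak_dtableau
    by (simp del: dtableau_to_carray_loop.simps)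
qed simp

lemma is_carray_snoc:
  "is_carray (S @ [c]) \<longleftrightarrow>
     is_carray S \<and> 0 < snd c \<and> snd c < fst c \<and> (S \<noteq> [] \<longrightarrow> lex_le (last S) c)"
proof -
  have "successively lex_le (S @ [c]) \<longleftrightarrow> successively lex_le S \<and> (S \<noteq> [] \<longrightarrow> lex_le (last S) c)"
    by (auto simp: successively_append_iff)
  then show ?thesis unfolding is_carray_def by (auto simp: successively_conv_nth split: prod.splits)
qed

lemma builds_is_carray: "builds N S T \<Longrightarrow> is_carray S"
proof (induction rule: builds.induct)
  case (Snoc S P c T)
  have "lex_le (last S) c" if "S \<noteq> []"
    using Snoc.hyps(1) that grow_lex_le[OF _ Snoc.hyps(2)] by cases auto
  then show ?case
    using Snoc.IH grow_bound(1,2)[of P "fst c" "snd c" T] Snoc.hyps(2) by (simp add: is_carray_snoc)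
qed (simp add: is_carray_def)

text \<open>
  It has to be shown that the path of \<open>b\<close> meets no \<open>a\<close>.  This is clear if \<open>a\<close> is new.  Otherwise
  the last step was by some \<open>(a, b1)\<close> with \<open>b1 \<le> b\<close>; by the row bumping lemma the path of \<open>b\<close> then
  stays within the rows of the previous path, and these contain no \<open>a\<close>.
\<close>

lemma builds_grow_ex:
  assumes "builds N S P" "is_carray (S @ [(a, b)])" "2 * length S < N"
  shows "\<exists>T. grow P (a, b) T"
proof -
  have ab: "0 < b" "b < a" "S \<noteq> [] \<longrightarrow> lex_le (last S) (a, b)"
    using assms(2) by (auto simp: is_carray_snoc)
  have empty: "[] \<in> set P"
    using builds_size[OF assms(1)] builds_weak_dtableau[OF assms(1)] assms(3) length_le_concat[of P] by linarith
  have v: "weak_dtableau P" using builds_weak_dtableau[OF assms(1)] by simp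
  show ?thesis
    using assms(1)
  proof cases
    case Nil
    then have "R = []" if "R \<in> set P" for R using that by simp
    then show ?thesis using grow_ex_upper[OF v empty ab(1,2)] by fastforce
  next
    case (Snoc S0 P0 c)
    obtain a1 b1 where c: "c = (a1, b1)" by fastforce
    have lex: "a1 < a \<or> a1 = a \<and> b1 \<le> b" using ab(3) Snoc c unfolding lex_le_def by simp
    note bd = grow_bound[OF Snoc(3)[unfolded c]]
    show ?thesis
    proof (rule grow_ex_upper[OF v empty ab(1,2)])
      show "\<forall>z \<in> set (concat P). z \<le> a" using bd(3) lex by fastforce
      fix A U Q A' u
      assume P: "P = A @ U # Q" "bumps A b A' u" "\<forall>z \<in> set U. z \<le> u"
      show "\<forall>R \<in> set A \<union> {U}. \<forall>z \<in> set R. z < a"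
      proof (cases "a1 = a")
        case False
        have "z < a" if "z \<in> set (concat P)" for z using bd(3) lex False that by fastforce
        then show ?thesis unfolding P(1) by auto
      next
        case True
        from Snoc(3) obtain A1 A1' u1 U1 V1 B1 where 1: "P = A1' @ (U1 @ [u1]) # (V1 @ [a]) # B1"
          "bumps A1 b1 A1' u1" "\<forall>z \<in> set U1. z \<le> u1" "\<forall>R \<in> set A1 \<union> {U1}. \<forall>z \<in> set R. z < a"
          unfolding c True by cases auto
        have "length A \<le> length A1"
          using bumps_twice[OF 1(2,3) P(2,3)] 1(1) P(1) lex True by (metis less_irrefl)
        then have "set (take (Suc (length A)) P) \<subseteq> set (take (Suc (length A1)) P)"
          by (intro set_take_subset_set_take) simp
        moreover have "take (Suc (length A)) P = A @ [U]" unfolding P(1) by simp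
        moreover have "take (Suc (length A1)) P = A1' @ [U1 @ [u1]]"
          using bumps_length[OF 1(2)] unfolding 1(1) by simp
        ultimately have sub: "set A \<union> {U} \<subseteq> set A1' \<union> {U1 @ [u1]}" by simp
        have "u1 < a \<and> (\<forall>R \<in> set A1'. \<forall>z \<in> set R. z < a)"
          using bumps_less[OF 1(2)] bd(1) 1(4) True by blast
        then have "\<forall>R \<in> set A1' \<union> {U1 @ [u1]}. \<forall>z \<in> set R. z < a" using 1(4) by auto
        then show ?thesis using sub by blast
      qed
    qed
  qed
qed

lemma builds_ex_tableau:
  assumes "is_carray S" "even N" "2 * length S \<le> N"
  shows "\<exists>T. builds N S T"
  using assms
proof (induction S rule: rev_induct)
  case (snoc c S)
  then obtain P where P: "builds N S P" by (auto simp: is_carray_snoc)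
  obtain T where "grow P c T"
    using builds_grow_ex[OF P, of "fst c" "snd c"] snoc.prems by auto
  then show ?case using builds.Snoc[OF P] by blast
qed (use builds.Nil in blast)

lemma builds_ex_array:
  assumes "weak_dtableau T"
  shows "\<exists>S. builds (length T) S T"
  using assms
proof (induction "length (concat T)" arbitrary: T rule: less_induct)
  case less
  show ?case
  proof (cases "concat T = []")
    case True
    then have "T = replicate (length T) []"
      by (metis concat_eq_Nil_conv replicate_eqI)
    moreover have "even (length T)" using less.prems paired_even unfolding weak_dtableau_def by fastforce
    ultimately show ?thesis using builds.Nil by metis
  next
    case False
    then obtain P c where g: "grow P c T" using grow_ex_lower less.prems by blast
    have "size (mset (concat P)) < size (mset (concat T))"
      using grow_mset[of P "fst c" "snd c" T] g by simp
    then obtain S where "builds (length P) S P"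
      using less.hyps[of P] g grow_weak_dtableau less.prems by auto
    then show ?thesis using builds.Snoc g grow_length by metis
  qed
qed

lemma builds_Carray2Dtableau:
  "builds (2 * length S) S T \<Longrightarrow> Carray2Dtableau S = Some (strip T)"
  using builds_carray_loop[of "2 * length S" S T "[]"] unfolding Carray2Dtableau_def by simp

lemma builds_Dtableau2Carray:
  assumes "builds N S T"
  shows "Dtableau2Carray (strip T) = Some S"
proof -
  have "concat (strip T) = concat T" by (induction T) auto
  then show ?thesis using builds_dtableau_loop[OF assms] builds_size[OF assms]
    unfolding Dtableau2Carray_def by simp
qed

text \<open>
  A d-tableau is padded to as many rows as it has entries, the number of rows with which
  \<open>Carray2Dtableau\<close> starts.
\<close>

lemma dtableau_builds:
  assumes "is_dtableau T"
  shows "\<exists>S P. builds (2 * length S) S P \<and> strip P = T"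
proof -
  have T: "weak_dtableau T" "[] \<notin> set T" using assms is_dtableau_iff by auto
  define N where "N = length (concat T)"
  have "even (length T)" "even N"
    using T(1) paired_even[of "map length T"] paired_even_sum[of "map length T"]
    unfolding weak_dtableau_def N_def length_concat by auto
  moreover have "length T \<le> N"
    using T(2) length_le_concat unfolding N_def by blast
  ultimately have P: "weak_dtableau (T @ replicate (N - length T) [])" "length (T @ replicate (N - length T) []) = N"
    using weak_dtableau_padded[OF T(1)] by auto
  then obtain S where S: "builds N S (T @ replicate (N - length T) [])" using builds_ex_array by metis
  then have "N = 2 * length S" using builds_size[OF S] unfolding N_def by simp
  moreover have "strip (T @ replicate (N - length T) []) = T"
    using T(2) by (simp add: filter_id_conv) metis
  ultimately show ?thesis using S by metis
qed

theorem proposition4p6: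
  shows "(\<forall>S. is_carray S \<longrightarrow>
            (\<exists>T. Carray2Dtableau S = Some T \<and> is_dtableau T \<and>
                 tableau_content T = array_content S)) \<and>
         (\<forall>T. is_dtableau T \<longrightarrow>
            (\<exists>S. Dtableau2Carray T = Some S \<and> is_carray S \<and>
                 array_content S = tableau_content T)) \<and>
         (\<forall>S T. is_carray S \<longrightarrow> is_dtableau T \<longrightarrow>
            (Carray2Dtableau S = Some T \<longleftrightarrow> Dtableau2Carray T = Some S))"
proof (intro conjI allI impI)
  fix S assume "is_carray S"
  then obtain T where T: "builds (2 * length S) S T" using builds_ex_tableau by fastforce
  have "is_dtableau (strip T)" using weak_dtableau_strip builds_weak_dtableau[OF T] is_dtableau_iff by auto
  then show "\<exists>T. Carray2Dtableau S = Some T \<and> is_dtableau T \<and> tableau_content T = array_content S"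
    using builds_Carray2Dtableau[OF T] builds_content[OF T] by blast
next
  fix T assume "is_dtableau T"
  then obtain S P where "builds (2 * length S) S P" "strip P = T" using dtableau_builds by blast
  then show "\<exists>S. Dtableau2Carray T = Some S \<and> is_carray S \<and> array_content S = tableau_content T"
    using builds_Dtableau2Carray builds_is_carray builds_content by metis
next
  fix S T assume S: "is_carray S" and T: "is_dtableau T"
  show "Carray2Dtableau S = Some T \<longleftrightarrow> Dtableau2Carray T = Some S"
  proof
    assume *: "Carray2Dtableau S = Some T"
    obtain P where P: "builds (2 * length S) S P" using S builds_ex_tableau by fastforce
    then show "Dtableau2Carray T = Some S"
      using * builds_Carray2Dtableau[OF P] builds_Dtableau2Carray[OF P] by simp
  next
    assume *: "Dtableau2Carray T = Some S"
    obtain S' P where P: "builds (2 * length S') S' P" "strip P = T" using T dtableau_builds by blast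
    then show "Carray2Dtableau S = Some T"
      using * builds_Carray2Dtableau[OF P(1)] builds_Dtableau2Carray[OF P(1)] by simp
  qed
qed

end
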